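(* Let $G,H\in\mathcal{RH}_\infty^{m\times m}$ with $H$ invertible. The closed-loop system $G(s)\#H(s)$ is stable if, for each $\omega\in[0,\infty)$, $$W(G(j\omega))\cap W\!\left(-\tfrac1\tau H^{-1}(j\omega)\right)=\varnothing\quad\text{for all }\tau\in(0,1].$$ Moreover, at any $\omega\in[0,\infty)$, the displayed condition at that $\omega$ implies $$DW(G(j\omega))\cap DW\!\left(-\tfrac1\tau H^{-1}(j\omega)\right)=\varnothing\quad\text{for all }\tau\in(0,1].$$
   Context: $\mathcal{RH}_\infty^{m\times m}$ is the set of real, rational, proper, stable $m\times m$ transfer function matrices. $H^{-1}(j\omega)$ denotes the inverse of $H$ evaluated at $j\omega$. For $G,H\in\mathcal{RH}_\infty^{m\times m}$, the standard (negative) feedback interconnection is described by $$G\#H=\begin{bmatrix}(I+HG)^{-1} & (I+HG)^{-1}H\\ G(I+HG)^{-1} & G(I+HG)^{-1}H\end{bmatrix},$$ and the closed-loop system is called stable if $G\#H\in\mathcal{RH}_\infty^{2m\times 2m}$. For $A\in\mathbb{C}^{n\times n}$, the numerical range is $W(A)=\{x^*Ax: x\in\mathbb{C}^n,\|x\|=1\}$ and the Davis-Wielandt (DW) shell is $DW(A)=\{(x^*Ax,\|Ax\|^2): x\in\mathbb{C}^n,\|x\|=1\}\subset\mathbb{C}\times\mathbb{R}$ (Euclidean norm).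
   Formalization: The stability claim also assumes I+τH(∞)G(∞) invertible for all τ∈(0,1]; without it the claim fails (G=-1, H=(s+1/2)/(s+1)). The displayed condition at ω is read as including that H(jω) is invertible, so that H^{-1}(jω) is defined. *)

theory Defs
  imports
    "HOL-Analysis.Analysis"
    "HOL-Computational_Algebra.Computational_Algebra"
    "HOL-Computational_Algebra.Field_as_Ring"
begin

section \<open>Real rational transfer functions\<close>

text \<open>A real rational function is an element of the field of fractions of \<^typ>\<open>real poly\<close>;
  \<^const>\<open>quot_of_fract\<close> returns its coprime numerator and (monic) denominator, so that the roots
  of the denominator are exactly the poles.\<close>

definition rat_num :: "real poly fract \<Rightarrow> real poly"
  where "rat_num f = fst (quot_of_fract f)"

definition rat_den :: "real poly fract \<Rightarrow> real poly"
  where "rat_den f = snd (quot_of_fract f)"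

text \<open>The value at \<open>s\<close> is meaningful only if \<open>s\<close> is not a pole (at a pole, division by zero
  returns \<open>0\<close>).\<close>

definition rat_eval :: "real poly fract \<Rightarrow> complex \<Rightarrow> complex"
  where "rat_eval f s =
    poly (map_poly complex_of_real (rat_num f)) s / poly (map_poly complex_of_real (rat_den f)) s"

definition proper_rat :: "real poly fract \<Rightarrow> bool"
  where "proper_rat f \<longleftrightarrow> degree (rat_num f) \<le> degree (rat_den f)"

definition stable_rat :: "real poly fract \<Rightarrow> bool"
  where "stable_rat f \<longleftrightarrow>
    (\<forall>s. 0 \<le> Re s \<longrightarrow> poly (map_poly complex_of_real (rat_den f)) s \<noteq> 0)"

text \<open>The limit of a proper rational function as \<open>s\<close> tends to infinity (zero if it is strictly
  proper).\<close>

definition rat_at_infinity :: "real poly fract \<Rightarrow> real"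
  where "rat_at_infinity f = coeff (rat_num f) (degree (rat_den f)) / lead_coeff (rat_den f)"


section \<open>Transfer function matrices\<close>

text \<open>Since \<^typ>\<open>real poly fract\<close> is a field, the matrix product \<open>**\<close>, \<^const>\<open>invertible\<close> and
  \<^const>\<open>matrix_inv\<close> on \<open>real poly fract ^ 'm ^ 'm\<close> are the operations on rational matrices.\<close>

definition RH_infinity :: "(real poly fract ^ 'n ^ 'n) set"
  where "RH_infinity = {G. \<forall>i j. proper_rat (G $ i $ j) \<and> stable_rat (G $ i $ j)}"

definition freq_response :: "real poly fract ^ 'n ^ 'n \<Rightarrow> real \<Rightarrow> complex ^ 'n ^ 'n"
  where "freq_response G \<omega> = (\<chi> i j. rat_eval (G $ i $ j) (\<i> * complex_of_real \<omega>))"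

definition response_at_infinity :: "real poly fract ^ 'n ^ 'n \<Rightarrow> real ^ 'n ^ 'n"
  where "response_at_infinity G = (\<chi> i j. rat_at_infinity (G $ i $ j))"

definition block_matrix ::
  "'a ^ 'm ^ 'm \<Rightarrow> 'a ^ 'm ^ 'm \<Rightarrow> 'a ^ 'm ^ 'm \<Rightarrow> 'a ^ 'm ^ 'm \<Rightarrow> 'a ^ ('m + 'm) ^ ('m + 'm)"
  where "block_matrix A B C D =
    (\<chi> i j. case i of
        Inl a \<Rightarrow> (case j of Inl b \<Rightarrow> A $ a $ b | Inr b \<Rightarrow> B $ a $ b)
      | Inr a \<Rightarrow> (case j of Inl b \<Rightarrow> C $ a $ b | Inr b \<Rightarrow> D $ a $ b))"

definition feedback ::
  "real poly fract ^ 'm ^ 'm \<Rightarrow> real poly fract ^ 'm ^ 'm \<Rightarrow>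
   real poly fract ^ ('m + 'm) ^ ('m + 'm)"
  where "feedback G H =
    (let S = matrix_inv (mat 1 + H ** G)
     in block_matrix S (S ** H) (G ** S) (G ** S ** H))"

text \<open>\<^const>\<open>matrix_inv\<close> is unspecified on singular matrices, so stability has to assert separately
  that the interconnection is defined.\<close>

definition closed_loop_stable ::
  "real poly fract ^ 'm ^ 'm \<Rightarrow> real poly fract ^ 'm ^ 'm \<Rightarrow> bool"
  where "closed_loop_stable G H \<longleftrightarrow>
    invertible (mat 1 + H ** G) \<and> feedback G H \<in> RH_infinity"


section \<open>Numerical range and Davis-Wielandt shell\<close>

definition quad_form :: "complex ^ 'n ^ 'n \<Rightarrow> complex ^ 'n \<Rightarrow> complex"
  where "quad_form A x = (\<Sum>i\<in>UNIV. cnj (x $ i) * (A *v x) $ i)"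

definition numerical_range :: "complex ^ 'n ^ 'n \<Rightarrow> complex set"
  where "numerical_range A = {quad_form A x | x. norm x = 1}"

definition DW_shell :: "complex ^ 'n ^ 'n \<Rightarrow> (complex \<times> real) set"
  where "DW_shell A = {(quad_form A x, (norm (A *v x))\<^sup>2) | x. norm x = 1}"

end

(* The Cayley transform z -> (1 + z) / (1 - z) carries the closed unit disc onto the closed right
   half-plane together with infinity, and turns every stable proper rational function into a function
   holomorphic on the closed disc. On the imaginary axis, a kernel vector of I + t H G would give a
   common point of the two numerical ranges, so det (I + t H G) has no zeros on the unit circle for
   0 <= t <= 1. It equals 1 at t = 0, and zeros can enter the disc only through the circle,
   so det (I + H G) has none in the closed disc and is a unit of the ring of stable proper functions;
   Cramer's rule then puts (I + H G)^-1 in that ring. *)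

theory Submission
  imports Defs "HOL-Complex_Analysis.Conformal_Mappings"
begin

section \<open>Values of rational functions\<close>

lemma Fract_rat_num_rat_den [simp]: "Fract (rat_num f) (rat_den f) = f"
  by (simp add: rat_num_def rat_den_def)

lemma rat_den_nonzero [simp]: "rat_den f \<noteq> 0"
  by (simp add: rat_den_def)

text \<open>Cross-multiplication and coprimality force the reduced denominator to divide
  \<open>b\<close>. Facts about an arbitrary representation thus carry over to the reduced pair on
  which values, poles and degrees are based.\<close>

lemma Fract_eq_reduced:
  assumes "b \<noteq> 0"
  obtains c where "c \<noteq> 0" "a = c * rat_num (Fract a b)" "b = c * rat_den (Fract a b)"
proof -
  define p q where "p = rat_num (Fract a b)" and "q = rat_den (Fract a b)"
  have "Fract p q = Fract a b" by (simp add: p_def q_def)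
  moreover have q0: "q \<noteq> 0" by (simp add: q_def)
  ultimately have cross: "p * b = a * q" using assms by (simp add: eq_fract)
  have "coprime p q"
    unfolding p_def q_def rat_num_def rat_den_def by (rule coprime_quot_of_fract)
  moreover have "q dvd p * b" using cross by simp
  ultimately have "q dvd b"
    by (simp add: coprime_commute coprime_dvd_mult_right_iff)
  then obtain c where c: "b = c * q" by (metis dvd_def mult.commute)
  moreover have "a = c * p" using cross c q0 by (simp add: algebra_simps)
  moreover have "c \<noteq> 0" using c assms by auto
  ultimately show ?thesis using that[of c, folded p_def q_def] by blast
qed

abbreviation cpoly :: "real poly \<Rightarrow> complex \<Rightarrow> complex"
  where "cpoly p s \<equiv> poly (map_poly complex_of_real p) s"

lemma cpoly_add: "cpoly (p + q) s = cpoly p s + cpoly q s"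
proof -
  have "map_poly complex_of_real (p + q) = map_poly of_real p + map_poly of_real q"
    by (rule poly_eqI) (simp add: coeff_map_poly)
  then show ?thesis by simp
qed

lemma cpoly_mult: "cpoly (p * q) s = cpoly p s * cpoly q s"
proof -
  have "map_poly complex_of_real (p * q) = map_poly of_real p * map_poly of_real q"
    by (rule poly_eqI) (simp add: coeff_map_poly coeff_mult)
  then show ?thesis by simp
qed

lemma cpoly_cnj: "cpoly p (cnj s) = cnj (cpoly p s)"
  by (simp add: poly_cnj map_poly_map_poly o_def)

text \<open>Every term of the convolution other than \<open>i = m\<close> has an index beyond one of
  the bounds. Bounds in place of exact degrees are essential: a strictly proper numerator is read at
  the larger degree of its denominator.\<close>

lemma coeff_mult_sum_degree_bounds:
  fixes p q :: "'a::comm_semiring_1 poly"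
  assumes "degree p \<le> m" "degree q \<le> n"
  shows "coeff (p * q) (m + n) = coeff p m * coeff q n"
proof -
  have "coeff p i * coeff q (m + n - i) = (if i = m then coeff p m * coeff q n else 0)"
    if "i \<le> m + n" for i
  proof (cases i m rule: linorder_cases)
    case less
    then have "coeff q (m + n - i) = 0" using assms by (intro coeff_eq_0) simp
    then show ?thesis using less by simp
  next
    case greater
    then have "coeff p i = 0" using assms by (intro coeff_eq_0) simp
    then show ?thesis using greater by simp
  qed simp
  then show ?thesis by (simp add: coeff_mult)
qed

lemma rat_eval_Fract:
  assumes "cpoly b s \<noteq> 0"
  shows "rat_eval (Fract a b) s = cpoly a s / cpoly b s"
proof -
  have "b \<noteq> 0" using assms by auto
  then obtain c where "a = c * rat_num (Fract a b)" "b = c * rat_den (Fract a b)"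
    by (rule Fract_eq_reduced)
  then have ab: "cpoly a s = cpoly c s * cpoly (rat_num (Fract a b)) s"
    "cpoly b s = cpoly c s * cpoly (rat_den (Fract a b)) s"
    by (metis cpoly_mult)+
  moreover have "cpoly c s \<noteq> 0" using assms ab by auto
  ultimately show ?thesis by (simp add: rat_eval_def)
qed

text \<open>The common factor adds the same degree above and below, and its leading coefficient
  cancels.\<close>

lemma rat_at_infinity_Fract:
  assumes "b \<noteq> 0" "degree a \<le> degree b"
  shows "proper_rat (Fract a b)"
    and "rat_at_infinity (Fract a b) = coeff a (degree b) / lead_coeff b"
proof -
  define p q where "p = rat_num (Fract a b)" and "q = rat_den (Fract a b)"
  from Fract_eq_reduced[OF assms(1)] obtain c
    where c: "c \<noteq> 0" "a = c * p" "b = c * q" unfolding p_def q_def by metis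
  have q: "q \<noteq> 0" using c assms by auto
  then have db: "degree b = degree c + degree q" using c by (simp add: degree_mult_eq)
  have dp: "degree p \<le> degree q"
    using assms(2) c db by (cases "p = 0") (simp_all add: degree_mult_eq)
  then show "proper_rat (Fract a b)" by (simp add: proper_rat_def p_def q_def)
  show "rat_at_infinity (Fract a b) = coeff a (degree b) / lead_coeff b"
    unfolding db rat_at_infinity_def p_def[symmetric] q_def[symmetric]
    using c dp by (simp add: coeff_mult_sum_degree_bounds)
qed

lemma stable_rat_Fract:
  assumes "\<And>s. 0 \<le> Re s \<Longrightarrow> cpoly b s \<noteq> 0"
  shows "stable_rat (Fract a b)"
proof -
  have "b \<noteq> 0" using assms[of 0] by auto
  then obtain c where "b = c * rat_den (Fract a b)" by (rule Fract_eq_reduced)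
  then have "cpoly b s = cpoly c s * cpoly (rat_den (Fract a b)) s" for s by (metis cpoly_mult)
  then show ?thesis using assms by (auto simp: stable_rat_def)
qed

lemma stable_ratD: "stable_rat f \<Longrightarrow> 0 \<le> Re s \<Longrightarrow> cpoly (rat_den f) s \<noteq> 0"
  by (simp add: stable_rat_def)

lemma add_Fract_rat: "f + g = Fract (rat_num f * rat_den g + rat_num g * rat_den f) (rat_den f * rat_den g)"
  by (metis Fract_rat_num_rat_den add_fract rat_den_nonzero)

lemma mult_Fract_rat: "f * g = Fract (rat_num f * rat_num g) (rat_den f * rat_den g)"
  by (metis Fract_rat_num_rat_den mult_fract)

lemma uminus_Fract_rat: "- f = Fract (- rat_num f) (rat_den f)"
  by (metis Fract_rat_num_rat_den minus_fract)

lemma rat_eval_cnj: "rat_eval f (cnj s) = cnj (rat_eval f s)"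
  by (simp add: rat_eval_def cpoly_cnj)


section \<open>The ring of stable proper rational functions\<close>

text \<open>Evaluation at a point is additive and multiplicative only away from poles, so the
  homomorphism lives on a subset \<open>S\<close> of the field. The lemmas below pair membership
  with the value, since each step needs both.\<close>

locale ring_hom_on =
  fixes S :: "'a::comm_ring_1 set" and \<phi> :: "'a \<Rightarrow> 'b::comm_ring_1"
  assumes one_mem: "1 \<in> S" and hom_one: "\<phi> 1 = 1"
    and add_mem: "\<And>x y. x \<in> S \<Longrightarrow> y \<in> S \<Longrightarrow> x + y \<in> S"
    and hom_add: "\<And>x y. x \<in> S \<Longrightarrow> y \<in> S \<Longrightarrow> \<phi> (x + y) = \<phi> x + \<phi> y"
    and mult_mem: "\<And>x y. x \<in> S \<Longrightarrow> y \<in> S \<Longrightarrow> x * y \<in> S"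
    and hom_mult: "\<And>x y. x \<in> S \<Longrightarrow> y \<in> S \<Longrightarrow> \<phi> (x * y) = \<phi> x * \<phi> y"
    and uminus_mem: "\<And>x. x \<in> S \<Longrightarrow> - x \<in> S"
begin

lemma zero_mem: "0 \<in> S"
  using add_mem[OF one_mem uminus_mem[OF one_mem]] by simp

lemma hom_zero: "\<phi> 0 = 0"
  using hom_add[OF zero_mem zero_mem] by simp

lemma hom_uminus: "x \<in> S \<Longrightarrow> \<phi> (- x) = - \<phi> x"
  using hom_add[of x "- x"] by (simp add: uminus_mem hom_zero eq_neg_iff_add_eq_0 add.commute)

lemma sum_hom:
  assumes "\<And>i. i \<in> I \<Longrightarrow> f i \<in> S"
  shows "sum f I \<in> S \<and> \<phi> (sum f I) = (\<Sum>i\<in>I. \<phi> (f i))"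
  using assms
  by (induction I rule: infinite_finite_induct) (auto simp: zero_mem hom_zero add_mem hom_add)

lemma prod_hom:
  assumes "\<And>i. i \<in> I \<Longrightarrow> f i \<in> S"
  shows "prod f I \<in> S \<and> \<phi> (prod f I) = (\<Prod>i\<in>I. \<phi> (f i))"
  using assms
  by (induction I rule: infinite_finite_induct) (auto simp: one_mem hom_one mult_mem hom_mult)

lemma matrix_mult_hom:
  fixes A :: "'a^'n^'m" and B :: "'a^'k^'n"
  assumes "\<And>i j. A $ i $ j \<in> S" "\<And>i j. B $ i $ j \<in> S"
  shows "(A ** B) $ i $ j \<in> S \<and>
    \<phi> ((A ** B) $ i $ j) = ((\<chi> i j. \<phi> (A $ i $ j)) ** (\<chi> i j. \<phi> (B $ i $ j))) $ i $ j"
  using sum_hom[of UNIV "\<lambda>k. A $ i $ k * B $ k $ j"] assms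
  by (simp add: matrix_matrix_mult_def mult_mem hom_mult)

lemma mat_one_hom:
  "(mat 1 :: 'a^'n^'n) $ i $ j \<in> S \<and> \<phi> ((mat 1 :: 'a^'n^'n) $ i $ j) = (mat 1 :: 'b^'n^'n) $ i $ j"
  by (simp add: mat_def one_mem zero_mem hom_one hom_zero)

text \<open>The Leibniz formula is a polynomial in the entries with coefficients 1 and -1.\<close>

lemma det_hom:
  fixes A :: "'a^'n^'n"
  assumes A: "\<And>i j. A $ i $ j \<in> S"
  shows "det A \<in> S \<and> \<phi> (det A) = det (\<chi> i j. \<phi> (A $ i $ j))"
proof -
  have sgn: "of_int (sign p) \<in> S \<and> \<phi> (of_int (sign p)) = of_int (sign p)" for p :: "'n \<Rightarrow> 'n"
    by (simp add: sign_def one_mem uminus_mem hom_one hom_uminus)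
  have prod: "(\<Prod>i\<in>UNIV. A $ i $ p i) \<in> S \<and>
      \<phi> (\<Prod>i\<in>UNIV. A $ i $ p i) = (\<Prod>i\<in>UNIV. \<phi> (A $ i $ p i))" for p
    by (rule prod_hom) (rule A)
  show ?thesis
    unfolding det_def
    using sum_hom[of "{p. p permutes UNIV}"
        "\<lambda>p. of_int (sign p) * (\<Prod>i\<in>UNIV. A $ i $ p i)"] sgn prod
    by (simp add: mult_mem hom_mult)
qed

end

lemma ring_hom_on_rat_eval:
  assumes "0 \<le> Re s"
  shows "ring_hom_on {f. stable_rat f} (\<lambda>f. rat_eval f s)"
proof
  show "1 \<in> {f. stable_rat f}" "rat_eval 1 s = 1"
    by (simp_all add: stable_rat_def rat_eval_def rat_num_def rat_den_def)
next
  fix f g assume "f \<in> {f. stable_rat f}" "g \<in> {f. stable_rat f}"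
  \<comment> \<open>This \<open>s\<close> ranges over the whole closed half-plane: closure under the
    operations needs all of it, the value equations only the fixed point.\<close>
  then have nz: "cpoly (rat_den f) s \<noteq> 0" "cpoly (rat_den g) s \<noteq> 0" if "0 \<le> Re s" for s
    using stable_ratD that by auto
  show "f + g \<in> {f. stable_rat f}" "f * g \<in> {f. stable_rat f}"
    unfolding add_Fract_rat[of f g] mult_Fract_rat[of f g]
    by (auto intro!: stable_rat_Fract simp: cpoly_mult nz)
  show "rat_eval (f + g) s = rat_eval f s + rat_eval g s"
    unfolding add_Fract_rat[of f g] using nz[OF assms]
    by (subst rat_eval_Fract) (simp_all add: cpoly_mult cpoly_add rat_eval_def add_frac_eq)
  show "rat_eval (f * g) s = rat_eval f s * rat_eval g s"
    unfolding mult_Fract_rat[of f g] using nz[OF assms]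
    by (subst rat_eval_Fract) (simp_all add: cpoly_mult rat_eval_def)
  show "- f \<in> {f. stable_rat f}"
    unfolding uminus_Fract_rat[of f] by (auto intro!: stable_rat_Fract simp: nz)
qed

lemma ring_hom_on_rat_at_infinity: "ring_hom_on {f. proper_rat f} rat_at_infinity"
proof
  show "1 \<in> {f. proper_rat f}" "rat_at_infinity 1 = 1"
    by (simp_all add: proper_rat_def rat_at_infinity_def rat_num_def rat_den_def)
next
  fix f g assume "f \<in> {f. proper_rat f}" "g \<in> {f. proper_rat f}"
  then have le: "degree (rat_num f) \<le> degree (rat_den f)"
    "degree (rat_num g) \<le> degree (rat_den g)"
    by (auto simp: proper_rat_def)
  have den: "rat_den f * rat_den g \<noteq> 0"
    "degree (rat_den f * rat_den g) = degree (rat_den f) + degree (rat_den g)"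
    by (simp_all add: degree_mult_eq)
  have ladd: "degree (rat_num f * rat_den g + rat_num g * rat_den f) \<le> degree (rat_den f * rat_den g)"
    unfolding den(2)
    by (rule degree_add_le; rule order_trans[OF degree_mult_le]) (use le in simp_all)
  have lmult: "degree (rat_num f * rat_num g) \<le> degree (rat_den f * rat_den g)"
    unfolding den(2) by (rule order_trans[OF degree_mult_le]) (use le in simp)
  show "f + g \<in> {f. proper_rat f}" "f * g \<in> {f. proper_rat f}"
    unfolding add_Fract_rat[of f g] mult_Fract_rat[of f g]
    using rat_at_infinity_Fract(1)[OF den(1)] ladd lmult by auto
  \<comment> \<open>The degree of the common denominator is where \<open>rat_at_infinity\<close>
    reads the numerator of the sum; each cross term factors there.\<close>
  have c1: "coeff (rat_num g * rat_den f) (degree (rat_den f) + degree (rat_den g))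
      = coeff (rat_num g) (degree (rat_den g)) * lead_coeff (rat_den f)"
    using coeff_mult_sum_degree_bounds[OF le(2) order_refl, of "rat_den f"] by (simp add: add.commute)
  have c2: "coeff (rat_num f * rat_den g) (degree (rat_den f) + degree (rat_den g))
      = coeff (rat_num f) (degree (rat_den f)) * lead_coeff (rat_den g)"
    by (rule coeff_mult_sum_degree_bounds[OF le(1) order_refl])
  show "rat_at_infinity (f + g) = rat_at_infinity f + rat_at_infinity g"
    unfolding add_Fract_rat[of f g]
    by (subst rat_at_infinity_Fract(2)[OF den(1) ladd])
       (simp add: den(2) c1 c2 lead_coeff_mult coeff_mult_degree_sum rat_at_infinity_def add_frac_eq)
  show "rat_at_infinity (f * g) = rat_at_infinity f * rat_at_infinity g"
    unfolding mult_Fract_rat[of f g]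
    by (subst rat_at_infinity_Fract(2)[OF den(1) lmult])
       (simp add: den(2) coeff_mult_degree_sum coeff_mult_sum_degree_bounds[OF le] rat_at_infinity_def)
  show "- f \<in> {f. proper_rat f}"
    unfolding uminus_Fract_rat[of f] using rat_at_infinity_Fract(1) le by auto
qed

definition RH_scalar :: "real poly fract set"
  where "RH_scalar = {f. proper_rat f \<and> stable_rat f}"

lemma RH_infinity_iff: "G \<in> RH_infinity \<longleftrightarrow> (\<forall>i j. G $ i $ j \<in> RH_scalar)"
  by (simp add: RH_infinity_def RH_scalar_def)

text \<open>Nonzero values in the closed half-plane keep zeros of the numerator, the poles of the
  inverse, out of it. A nonzero value at infinity makes the numerator degree at least the
  denominator degree, so the inverse is proper.\<close>

lemma inverse_RH_scalar:
  assumes f: "f \<in> RH_scalar"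
    and fin: "\<And>s. 0 \<le> Re s \<Longrightarrow> rat_eval f s \<noteq> 0"
    and inf: "rat_at_infinity f \<noteq> 0"
  shows "f \<noteq> 0" "inverse f \<in> RH_scalar"
proof -
  have num: "cpoly (rat_num f) s \<noteq> 0" if "0 \<le> Re s" for s
    using fin[OF that] by (auto simp: rat_eval_def)
  then have n0: "rat_num f \<noteq> 0" by (metis map_poly_0 poly_0 order_refl zero_complex.simps(1))
  have inv: "inverse f = Fract (rat_den f) (rat_num f)"
    by (metis Fract_rat_num_rat_den inverse_fract)
  have "degree (rat_den f) \<le> degree (rat_num f)"
    using inf by (auto simp: rat_at_infinity_def intro: le_degree)
  then have "proper_rat (inverse f)"
    unfolding inv by (rule rat_at_infinity_Fract(1)[OF n0])
  moreover have "stable_rat (inverse f)"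
    unfolding inv by (rule stable_rat_Fract) (rule num)
  ultimately show "inverse f \<in> RH_scalar" by (simp add: RH_scalar_def)
  show "f \<noteq> 0" using n0 by (auto simp: rat_num_def)
qed


section \<open>Transfer to the unit disc\<close>

text \<open>The point \<open>z = 1\<close> stands for infinity under the Cayley transform.\<close>

definition disc_eval :: "real poly fract \<Rightarrow> complex \<Rightarrow> complex"
  where "disc_eval f z =
    (if z = 1 then of_real (rat_at_infinity f) else rat_eval f ((1 + z) / (1 - z)))"

text \<open>The sign of the right side sends the disc to the half-plane and the circle to the
  imaginary axis. At \<open>z = 1\<close> both sides are 0 by the convention for division by
  zero.\<close>

lemma Re_cayley:
  "Re ((1 + z) / (1 - z)) = (1 - (norm z)\<^sup>2) / (norm (1 - z))\<^sup>2"
  by (simp add: Re_divide cmod_power2) (simp add: power2_eq_square algebra_simps)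

lemma ring_hom_on_disc_eval:
  assumes "norm z \<le> 1"
  shows "ring_hom_on RH_scalar (\<lambda>f. disc_eval f z)"
proof -
  interpret inf: ring_hom_on "{f. proper_rat f}" rat_at_infinity
    by (rule ring_hom_on_rat_at_infinity)
  have re: "0 \<le> Re ((1 + z) / (1 - z))"
    unfolding Re_cayley using assms by (simp add: power_le_one)
  interpret ev: ring_hom_on "{f. stable_rat f}" "\<lambda>f. rat_eval f ((1 + z) / (1 - z))"
    by (rule ring_hom_on_rat_eval[OF re])
  show ?thesis
    using inf.one_mem inf.hom_one inf.add_mem inf.hom_add inf.mult_mem inf.hom_mult inf.uminus_mem
      ev.one_mem ev.hom_one ev.add_mem ev.hom_add ev.mult_mem ev.hom_mult ev.uminus_mem
    by unfold_locales (auto simp: RH_scalar_def disc_eval_def)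
qed

text \<open>The homogenization of \<open>p\<close> in degree \<open>n\<close>, taken at the pair
  \<open>1 + z\<close>, \<open>1 - z\<close>. With \<open>n\<close> a parameter, numerator and
  denominator can be cleared by the same power of \<open>1 - z\<close>.\<close>

definition cayley_poly :: "nat \<Rightarrow> real poly \<Rightarrow> complex \<Rightarrow> complex"
  where "cayley_poly n p z = (\<Sum>k\<le>n. of_real (coeff p k) * (1 + z) ^ k * (1 - z) ^ (n - k))"

lemma cayley_poly_eq:
  assumes "z \<noteq> 1" "degree p \<le> n"
  shows "cayley_poly n p z = (1 - z) ^ n * cpoly p ((1 + z) / (1 - z))"
proof -
  have "cpoly p s = (\<Sum>k\<le>n. of_real (coeff p k) * s ^ k)" for s
  proof -
    have "degree (map_poly complex_of_real p) \<le> n"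
      using assms(2) map_poly_degree_leq order_trans by blast
    then show ?thesis
      by (subst poly_as_sum_of_monoms'[symmetric, of _ n])
         (auto simp: poly_sum poly_monom coeff_map_poly)
  qed
  moreover have "(1 - z) ^ n = (1 - z) ^ k * (1 - z) ^ (n - k)" if "k \<le> n" for k
    using that by (simp flip: power_add)
  ultimately show ?thesis
    using assms(1)
    by (auto simp: cayley_poly_def sum_distrib_left power_divide intro!: sum.cong)
qed

lemma cayley_poly_one: "cayley_poly n p 1 = of_real (coeff p n) * 2 ^ n"
proof -
  have "cayley_poly n p 1 = (\<Sum>k\<le>n. if k = n then of_real (coeff p n) * 2 ^ n else 0)"
    unfolding cayley_poly_def by (rule sum.cong) auto
  then show ?thesis by simp
qed

text \<open>One quotient of polynomials in \<open>z\<close> covers both cases of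
  \<open>disc_eval\<close>: the common factor is \<open>(1 - z) ^ n\<close> away from 1 and
  \<open>2 ^ n\<close> at 1. This removes the apparent singularity at \<open>z = 1\<close>.\<close>

lemma disc_eval_eq_cayley_poly:
  assumes f: "f \<in> RH_scalar" and z: "norm z \<le> 1"
  shows "cayley_poly (degree (rat_den f)) (rat_den f) z \<noteq> 0"
    and "disc_eval f z = cayley_poly (degree (rat_den f)) (rat_num f) z /
      cayley_poly (degree (rat_den f)) (rat_den f) z"
proof -
  have "0 \<le> Re ((1 + z) / (1 - z))"
    unfolding Re_cayley using z by (simp add: power_le_one)
  then have "cpoly (rat_den f) ((1 + z) / (1 - z)) \<noteq> 0"
    using f by (intro stable_ratD) (simp_all add: RH_scalar_def)
  then show "cayley_poly (degree (rat_den f)) (rat_den f) z \<noteq> 0"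
    by (cases "z = 1") (simp_all add: cayley_poly_one cayley_poly_eq)
  show "disc_eval f z = cayley_poly (degree (rat_den f)) (rat_num f) z /
      cayley_poly (degree (rat_den f)) (rat_den f) z"
    using f
    by (cases "z = 1") (simp_all add: cayley_poly_one cayley_poly_eq disc_eval_def
        rat_at_infinity_def rat_eval_def RH_scalar_def proper_rat_def)
qed

lemma disc_eval_holomorphic:
  assumes "f \<in> RH_scalar"
  shows "(\<lambda>z. disc_eval f z) holomorphic_on cball 0 1"
proof -
  have "(\<lambda>z. cayley_poly (degree (rat_den f)) (rat_num f) z /
      cayley_poly (degree (rat_den f)) (rat_den f) z) holomorphic_on cball 0 1"
    using disc_eval_eq_cayley_poly(1)[OF assms] unfolding cayley_poly_def
    by (intro holomorphic_intros) simp
  then show ?thesis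
    by (rule holomorphic_transform) (simp add: disc_eval_eq_cayley_poly(2)[OF assms])
qed

lemma RH_scalar_inverse_disc:
  assumes f: "f \<in> RH_scalar" and nz: "\<And>z. norm z \<le> 1 \<Longrightarrow> disc_eval f z \<noteq> 0"
  shows "f \<noteq> 0" "inverse f \<in> RH_scalar"
proof -
  have fin: "rat_eval f s \<noteq> 0" if s: "0 \<le> Re s" for s
  proof -
    \<comment> \<open>The inverse Cayley transform; it lands in the disc because \<open>s\<close> is
      no farther from 1 than from -1.\<close>
    define z where "z = (s - 1) / (s + 1)"
    have s1: "s + 1 \<noteq> 0" using s by (auto simp: complex_eq_iff)
    have "(norm (s - 1))\<^sup>2 \<le> (norm (s + 1))\<^sup>2"
      unfolding cmod_power2 using s by (simp add: power2_eq_square algebra_simps)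
    then have "norm (s - 1) \<le> norm (s + 1)" by (rule power2_le_imp_le) simp
    then have "norm z \<le> 1" using s1 by (simp add: z_def norm_divide divide_le_eq_1)
    moreover have z1: "z \<noteq> 1" using s1 by (simp add: z_def)
    moreover have "(1 + z) / (1 - z) = s"
    proof -
      have "1 + z = 2 * s / (s + 1)" "1 - z = 2 / (s + 1)"
        using s1 by (simp_all add: z_def diff_divide_eq_iff add_divide_eq_iff)
      then show ?thesis using s1 by simp
    qed
    ultimately show ?thesis using nz[of z] by (simp add: disc_eval_def)
  qed
  have inf: "rat_at_infinity f \<noteq> 0" using nz[of 1] by (simp add: disc_eval_def)
  show "f \<noteq> 0" "inverse f \<in> RH_scalar" using inverse_RH_scalar[OF f fin inf] by auto
qed


section \<open>Zeros along a homotopy\<close>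

text \<open>On a zero-free member of the family, the maximum principle for \<open>1 / d t\<close> upgrades ``no zeros''
  to the bound \<open>c\<close> that holds on the frontier, so zero-freeness propagates in steps of uniform length.\<close>

lemma homotopy_zero_free:
  fixes d :: "real \<Rightarrow> complex \<Rightarrow> complex"
  assumes S: "compact S"
    and cont: "continuous_on ({0..1} \<times> S) (\<lambda>(t, z). d t z)"
    and hol: "\<And>t. t \<in> {0..1} \<Longrightarrow> d t holomorphic_on interior S"
    and frontier: "\<And>t z. t \<in> {0..1} \<Longrightarrow> z \<in> frontier S \<Longrightarrow> d t z \<noteq> 0"
    and start: "\<And>z. z \<in> S \<Longrightarrow> d 0 z \<noteq> 0"
    and z: "z \<in> S"
  shows "d 1 z \<noteq> 0"
proof -
  have frS: "frontier S \<subseteq> S" using S by (simp add: compact_imp_closed frontier_subset_closed)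
  \<comment> \<open>Taking the image over all \<open>t\<close> at once makes the separation
    \<open>c\<close> from 0 independent of \<open>t\<close>.\<close>
  have "compact ((\<lambda>(t, z). d t z) ` ({0..1} \<times> frontier S))"
    using S frS by (intro compact_continuous_image continuous_on_subset[OF cont] compact_Times)
      (auto intro: compact_frontier)
  moreover have "0 \<notin> (\<lambda>(t, z). d t z) ` ({0..1} \<times> frontier S)" using frontier by force
  ultimately obtain c where c: "c > 0"
      "\<And>w. w \<in> (\<lambda>(t, z). d t z) ` ({0..1} \<times> frontier S) \<Longrightarrow> c \<le> dist 0 w"
    using separate_point_closed[OF compact_imp_closed] by metis
  have bound: "c \<le> norm (d t z)" if t: "t \<in> {0..1}" and nz: "\<And>z. z \<in> S \<Longrightarrow> d t z \<noteq> 0" and z: "z \<in> S" for t z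
  proof -
    have "continuous_on S (\<lambda>z. (t, z))" by (intro continuous_intros)
    moreover have "Pair t ` S \<subseteq> {0..1} \<times> S" using t by auto
    ultimately have ct: "continuous_on S (d t)" using continuous_on_compose2[OF cont] by force
    have "norm (inverse (d t z)) \<le> inverse c"
    proof (rule maximum_modulus_frontier[of "\<lambda>z. inverse (d t z)" S])
      show "(\<lambda>z. inverse (d t z)) holomorphic_on interior S"
        using nz interior_subset by (intro holomorphic_intros hol t) blast
      show "continuous_on (closure S) (\<lambda>z. inverse (d t z))"
        using nz ct S by (simp add: compact_imp_closed continuous_on_inverse)
      show "norm (inverse (d t z)) \<le> inverse c" if "z \<in> frontier S" for z
        using c t that by (force simp: norm_inverse intro!: le_imp_inverse_le)
    qed (use S z compact_imp_bounded in auto)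
    then show ?thesis using c(1) nz[OF z] by (simp add: norm_inverse)
  qed
  \<comment> \<open>A parameter step shorter than \<open>\<delta>\<close> moves every value by less
    than \<open>c\<close>, so it cannot reach 0 from a zero-free member.\<close>
  have "uniformly_continuous_on ({0..1} \<times> S) (\<lambda>(t, z). d t z)"
    using cont S by (intro compact_uniformly_continuous compact_Times) auto
  then obtain \<delta> where \<delta>: "\<delta> > 0" "\<And>p q. p \<in> {0..1} \<times> S \<Longrightarrow> q \<in> {0..1} \<times> S \<Longrightarrow> dist q p < \<delta>
      \<Longrightarrow> dist ((\<lambda>(t, z). d t z) q) ((\<lambda>(t, z). d t z) p) < c"
    using c(1) unfolding uniformly_continuous_on_def by metis
  obtain n :: nat where n: "n > 0" "inverse (real n) < \<delta>"
    using \<delta>(1) by (meson reals_Archimedean zero_less_Suc)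
  have "\<forall>z\<in>S. d (real k / real n) z \<noteq> 0" if "k \<le> n" for k
    using that
  proof (induction k)
    case 0
    then show ?case using start by simp
  next
    case (Suc k)
    have k: "real k / real n \<in> {0..1}" "real (Suc k) / real n \<in> {0..1}"
      using Suc.prems n by (simp_all add: divide_le_eq_1)
    have step: "dist (real (Suc k) / real n) (real k / real n) < \<delta>"
      using n by (simp add: dist_real_def add_divide_distrib inverse_eq_divide)
    show ?case
    proof
      fix z assume z: "z \<in> S"
      have "c \<le> norm (d (real k / real n) z)"
        using Suc z k(1) by (intro bound) auto
      moreover have "dist (d (real (Suc k) / real n) z) (d (real k / real n) z) < c"
        using \<delta>(2)[of "(real k / real n, z)" "(real (Suc k) / real n, z)"] k z step
        by (simp add: dist_Pair_Pair)
      ultimately show "d (real (Suc k) / real n) z \<noteq> 0" by auto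
    qed
  qed
  from this[of n] show ?thesis using n z by simp
qed


section \<open>Numerical ranges and the closed loop\<close>

text \<open>The first coordinate of a point of the shell lies in the numerical range.\<close>

lemma DW_shells_disjoint:
  assumes "numerical_range A \<inter> numerical_range B = {}"
  shows "DW_shell A \<inter> DW_shell B = {}"
  using assms unfolding numerical_range_def DW_shell_def by fastforce

lemma matrix_inv:
  assumes "invertible A"
  shows "A ** matrix_inv A = mat 1" "matrix_inv A ** A = mat 1"
  using someI_ex[OF assms[unfolded invertible_def]] by (auto simp: matrix_inv_def)

lemma scaleR_matrix_vector_mult:
  fixes A :: "'a::real_algebra_1^'n^'m"
  shows "(c *\<^sub>R A) *v x = c *\<^sub>R (A *v x)"
  by (simp add: vec_eq_iff matrix_vector_mult_def scaleR_sum_right)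

lemma matrix_vector_mult_scaleR_right:
  fixes A :: "'a::real_algebra_1^'n^'m"
  shows "A *v (c *\<^sub>R x) = c *\<^sub>R (A *v x)"
  by (simp add: vec_eq_iff matrix_vector_mult_def scaleR_sum_right)

lemma invertible_of_disjoint_numerical_ranges:
  fixes A B :: "complex ^ 'n ^ 'n"
  assumes B: "invertible B" and t: "0 < t"
    and disj: "numerical_range A \<inter> numerical_range (- (1 / t) *\<^sub>R matrix_inv B) = {}"
  shows "det (mat 1 + t *\<^sub>R (B ** A)) \<noteq> 0"
proof
  assume "det (mat 1 + t *\<^sub>R (B ** A)) = 0"
  then have "\<not> invertible (mat 1 + t *\<^sub>R (B ** A))" by (simp add: invertible_det_nz)
  then obtain x where x: "x \<noteq> 0" "(mat 1 + t *\<^sub>R (B ** A)) *v x = 0"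
    by (auto simp: invertible_left_inverse matrix_left_invertible_ker)
  have "x + t *\<^sub>R (B *v (A *v x)) = 0"
    using x(2) by (simp add: matrix_vector_mult_add_rdistrib scaleR_matrix_vector_mult
        matrix_vector_mul_assoc)
  then have "x = - t *\<^sub>R (B *v (A *v x))" by (simp add: eq_neg_iff_add_eq_0)
  then have "matrix_inv B *v x = - t *\<^sub>R (matrix_inv B *v (B *v (A *v x)))"
    by (metis matrix_vector_mult_scaleR_right)
  then have "matrix_inv B *v x = - t *\<^sub>R (A *v x)"
    using B by (simp add: matrix_vector_mul_assoc matrix_mul_assoc matrix_inv)
  \<comment> \<open>Both matrices send the kernel vector to the same vector, so their quadratic
    forms agree at its normalization.\<close>
  then have Ax: "(- (1 / t) *\<^sub>R matrix_inv B) *v x = A *v x"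
    unfolding scaleR_matrix_vector_mult using t by simp
  define y where "y = (1 / norm x) *\<^sub>R x"
  have y: "norm y = 1" using x by (simp add: y_def)
  have "quad_form (- (1 / t) *\<^sub>R matrix_inv B) y = quad_form A y"
    unfolding quad_form_def y_def matrix_vector_mult_scaleR_right Ax ..
  then show False using y disj unfolding numerical_range_def by blast
qed

lemma feedback_RH_infinity:
  fixes G H :: "real poly fract ^ 'm ^ 'm"
  assumes G: "G \<in> RH_infinity" and H: "H \<in> RH_infinity"
    and nz: "\<And>z. norm z \<le> 1 \<Longrightarrow> det (mat 1 +
      (\<chi> i j. disc_eval (H $ i $ j) z) ** (\<chi> i j. disc_eval (G $ i $ j) z)) \<noteq> 0"
  shows "closed_loop_stable G H"
proof -
  note G' = G[unfolded RH_infinity_iff, rule_format] and H' = H[unfolded RH_infinity_iff, rule_format]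
  \<comment> \<open>Only the closure properties of \<open>RH_scalar\<close> are wanted here; any
    point of the disc would serve.\<close>
  interpret R: ring_hom_on RH_scalar "\<lambda>f. disc_eval f 0"
    by (rule ring_hom_on_disc_eval) simp
  have mult: "(A ** B) $ i $ j \<in> RH_scalar"
    if "\<And>i j. A $ i $ j \<in> RH_scalar" "\<And>i j. B $ i $ j \<in> RH_scalar"
    for A B :: "real poly fract ^ 'm ^ 'm" and i j
    using R.matrix_mult_hom that by blast
  define M where "M = mat 1 + H ** G"
  have M: "M $ i $ j \<in> RH_scalar" for i j
    unfolding M_def vector_add_component
    by (intro R.add_mem R.mat_one_hom[THEN conjunct1] mult H' G')
  have det_M: "det M \<in> RH_scalar" using R.det_hom M by blast
  have "disc_eval (det M) z \<noteq> 0" if z: "norm z \<le> 1" for z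
  proof -
    interpret Z: ring_hom_on RH_scalar "\<lambda>f. disc_eval f z" by (rule ring_hom_on_disc_eval[OF z])
    have "(\<chi> i j. disc_eval (M $ i $ j) z) = mat 1 +
        (\<chi> i j. disc_eval (H $ i $ j) z) ** (\<chi> i j. disc_eval (G $ i $ j) z)"
      unfolding vec_eq_iff M_def using Z.matrix_mult_hom[OF H' G']
      by (simp add: Z.hom_add Z.mat_one_hom)
    then show ?thesis using Z.det_hom[of M] M nz[OF z] by simp
  qed
  note D = RH_scalar_inverse_disc[OF det_M this]
  then have inv: "invertible M" by (simp add: invertible_det_nz)
  define S where "S = matrix_inv M"
  have S: "S $ i $ j \<in> RH_scalar" for i j
  proof -
    \<comment> \<open>With a standard basis vector on the right, Cramer's rule computes column
      \<open>j\<close> of the inverse.\<close>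
    define b where "b = (axis j 1 :: real poly fract ^ 'm)"
    have "M *v (S *v b) = b"
      using inv by (simp add: S_def matrix_vector_mul_assoc matrix_inv)
    then have "S *v b = (\<chi> k. det (\<chi> i j. if j = k then b $ i else M $ i $ j) / det M)"
      using cramer[OF D(1)] by blast
    moreover have "(S *v b) $ i = S $ i $ j"
      by (simp add: b_def matrix_vector_mult_def axis_def if_distrib cong: if_cong)
    ultimately have "S $ i $ j = det (\<chi> k l. if l = i then b $ k else M $ k $ l) * inverse (det M)"
      by (simp add: divide_inverse)
    moreover have "det (\<chi> k l. if l = i then b $ k else M $ k $ l) \<in> RH_scalar"
      by (rule R.det_hom[THEN conjunct1])
         (use M R.zero_mem R.one_mem in \<open>simp add: b_def axis_def\<close>)
    ultimately show ?thesis using D(2) R.mult_mem by simp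
  qed
  have "feedback G H \<in> RH_infinity"
    unfolding RH_infinity_iff feedback_def Let_def M_def[symmetric] S_def[symmetric] block_matrix_def
    using S mult[OF S H'] mult[OF G' S] mult[OF mult[OF G' S] H']
    by (auto split: sum.split)
  then show ?thesis using inv by (simp add: closed_loop_stable_def M_def)
qed

lemma det_cnj: "det (\<chi> i j. cnj (A $ i $ j)) = cnj (det A)"
  by (simp add: det_def)

lemma det_of_real: "det (\<chi> i j. complex_of_real (A $ i $ j)) = of_real (det A)"
  by (simp add: det_def)

text \<open>The condition at infinity covers the boundary point that no finite frequency reaches.
  Disjointness may be lost in the limit: for \<open>m = 1\<close>, \<open>H = 1\<close> and
  \<open>G = -s/(s+1)\<close> it holds at every finite frequency, yet
  \<open>1 + H G = 1/(s+1)\<close> has an improper inverse. Invertibility of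
  \<open>freq_response H \<omega>\<close> gives \<open>matrix_inv\<close> its meaning.\<close>

theorem lemma4p2:
  fixes G H :: "real poly fract ^ 'm ^ 'm"
  assumes "G \<in> RH_infinity" and "H \<in> RH_infinity" and "invertible H"
  shows
    "((\<forall>\<tau>\<in>{0<..1}. invertible (mat 1 + \<tau> *\<^sub>R (response_at_infinity H ** response_at_infinity G))) \<and>
      (\<forall>\<omega>\<ge>0. invertible (freq_response H \<omega>) \<and>
         (\<forall>\<tau>\<in>{0<..1}. numerical_range (freq_response G \<omega>) \<inter>
            numerical_range (- (1 / \<tau>) *\<^sub>R matrix_inv (freq_response H \<omega>)) = {}))
      \<longrightarrow> closed_loop_stable G H) \<and>
     (\<forall>\<omega>\<ge>0. invertible (freq_response H \<omega>) \<and>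
         (\<forall>\<tau>\<in>{0<..1}. numerical_range (freq_response G \<omega>) \<inter>
            numerical_range (- (1 / \<tau>) *\<^sub>R matrix_inv (freq_response H \<omega>)) = {})
      \<longrightarrow> (\<forall>\<tau>\<in>{0<..1}. DW_shell (freq_response G \<omega>) \<inter>
            DW_shell (- (1 / \<tau>) *\<^sub>R matrix_inv (freq_response H \<omega>)) = {}))"
proof (intro conjI impI)
  assume hyp: "(\<forall>\<tau>\<in>{0<..1}. invertible (mat 1 + \<tau> *\<^sub>R (response_at_infinity H ** response_at_infinity G))) \<and>
      (\<forall>\<omega>\<ge>0. invertible (freq_response H \<omega>) \<and>
         (\<forall>\<tau>\<in>{0<..1}. numerical_range (freq_response G \<omega>) \<inter>
            numerical_range (- (1 / \<tau>) *\<^sub>R matrix_inv (freq_response H \<omega>)) = {}))"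
  note G' = assms(1)[unfolded RH_infinity_iff, rule_format]
    and H' = assms(2)[unfolded RH_infinity_iff, rule_format]
  define E where "E = (\<lambda>(K :: real poly fract ^ 'm ^ 'm) z. \<chi> i j. disc_eval (K $ i $ j) z)"
  define d where "d = (\<lambda>t z. det (mat 1 + t *\<^sub>R (E H z ** E G z)))"
  have freq: "det (mat 1 + t *\<^sub>R (freq_response H \<omega> ** freq_response G \<omega>)) \<noteq> 0"
    if t: "t \<in> {0<..1}" for t \<omega>
  proof -
    have nonneg: "det (mat 1 + t *\<^sub>R (freq_response H \<omega> ** freq_response G \<omega>)) \<noteq> 0" if "0 \<le> \<omega>" for \<omega>
      using hyp that t by (intro invertible_of_disjoint_numerical_ranges) auto
    show ?thesis
    proof (cases "0 \<le> \<omega>")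
      case False
      \<comment> \<open>The hypothesis speaks of nonnegative frequencies only; real coefficients
        make the determinant at a negative one a complex conjugate.\<close>
      have "rat_eval f (- (\<i> * complex_of_real \<omega>)) = cnj (rat_eval f (\<i> * complex_of_real \<omega>))" for f
        by (simp flip: rat_eval_cnj)
      then have "mat 1 + t *\<^sub>R (freq_response H (- \<omega>) ** freq_response G (- \<omega>)) =
          (\<chi> i j. cnj ((mat 1 + t *\<^sub>R (freq_response H \<omega> ** freq_response G \<omega>)) $ i $ j))"
        by (simp add: vec_eq_iff freq_response_def matrix_matrix_mult_def mat_def)
      then have "det (mat 1 + t *\<^sub>R (freq_response H (- \<omega>) ** freq_response G (- \<omega>))) =
          cnj (det (mat 1 + t *\<^sub>R (freq_response H \<omega> ** freq_response G \<omega>)))"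
        by (simp only: det_cnj)
      then show ?thesis using nonneg[of "- \<omega>"] False by simp
    qed (rule nonneg)
  qed
  have E_freq: "E K z = freq_response K (Im ((1 + z) / (1 - z)))" if "norm z = 1" "z \<noteq> 1" for K z
  proof -
    have "Re ((1 + z) / (1 - z)) = 0" unfolding Re_cayley using that by simp
    then have "(1 + z) / (1 - z) = \<i> * of_real (Im ((1 + z) / (1 - z)))"
      by (simp add: complex_eq_iff)
    then show ?thesis using that by (simp add: E_def freq_response_def disc_eval_def vec_eq_iff)
  qed
  have d_0: "d 0 z = 1" for z by (simp add: d_def)
  \<comment> \<open>Three cases: \<open>t = 0\<close>, where \<open>d\<close> is constantly 1;
    \<open>z = 1\<close>, the condition at infinity; and the rest, the imaginary axis.\<close>
  have circle: "d t z \<noteq> 0" if t: "t \<in> {0..1}" and z: "norm z = 1" for t z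
  proof (cases "t = 0")
    case False
    then have t': "t \<in> {0<..1}" using t by auto
    show ?thesis
    proof (cases "z = 1")
      case True
      have "mat 1 + t *\<^sub>R (E H 1 ** E G 1) = (\<chi> i j. complex_of_real
          ((mat 1 + t *\<^sub>R (response_at_infinity H ** response_at_infinity G)) $ i $ j))"
        by (simp add: vec_eq_iff E_def disc_eval_def response_at_infinity_def
            matrix_matrix_mult_def mat_def scaleR_conv_of_real[where 'a=complex])
      then have "d t 1 = of_real (det (mat 1 + t *\<^sub>R (response_at_infinity H ** response_at_infinity G)))"
        unfolding d_def by (simp only: det_of_real)
      then show ?thesis using hyp t' True by (simp add: invertible_det_nz)
    next
      case False
      show ?thesis unfolding d_def E_freq[OF z False] by (rule freq[OF t'])
    qed
  qed (simp add: d_0)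
  \<comment> \<open>Expanded to sums and products of scalar functions, so that holomorphy in
    \<open>z\<close> and joint continuity follow from those of the entries.\<close>
  have d_eq: "d t z = (\<Sum>p | p permutes UNIV. of_int (sign p) * (\<Prod>i\<in>UNIV. mat 1 $ i $ p i +
      of_real t * (\<Sum>k\<in>UNIV. disc_eval (H $ i $ k) z * disc_eval (G $ k $ p i) z)))" for t z
    by (simp add: d_def E_def det_def matrix_matrix_mult_def scaleR_conv_of_real[where 'a=complex])
  have hol: "d t holomorphic_on cball 0 1" for t
    unfolding d_eq by (intro holomorphic_intros disc_eval_holomorphic G' H')
  have cont_entry: "continuous_on ({0..1} \<times> cball 0 1) (\<lambda>p. disc_eval f (snd p))"
    if "f \<in> RH_scalar" for f :: "real poly fract"
    by (rule continuous_on_compose2[OF holomorphic_on_imp_continuous_on[OF disc_eval_holomorphic[OF that]]])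
       (auto intro!: continuous_intros)
  have cont: "continuous_on ({0..1} \<times> cball 0 1) (\<lambda>(t, z). d t z)"
    unfolding d_eq case_prod_unfold by (intro continuous_intros cont_entry G' H')
  \<comment> \<open>The frontier of the disc is the circle, where \<open>circle\<close> applies;
    \<open>t = 1\<close> is the actual loop.\<close>
  have "d 1 z \<noteq> 0" if "norm z \<le> 1" for z
    by (rule homotopy_zero_free[of "cball 0 1" d])
       (use that cont hol circle d_0 in \<open>auto intro: holomorphic_on_subset[OF _ ball_subset_cball]\<close>)
  then show "closed_loop_stable G H"
    by (intro feedback_RH_infinity assms) (simp add: d_def E_def)
qed (use DW_shells_disjoint in blast)

end
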